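(* Let $B^{(n)}$, $Q^{(n)}$, $J$, $N$ be associated with $(\mu,\vec w,\vec n)$ as in the context, and let $\lambda$ be a real point at which the weights are defined. Assume that the limits $\lim_{n\to\infty}J_{n+j,n}=c_j$ exist for $j=0,\dots,N$, with $c_N\neq0$, and put $$\varphi(r)=c_N+c_{N-1}r+\dots+c_1r^{N-1}+(c_0-\lambda)r^N+r^{N+1}.$$ Assume moreover the ratio asymptotics $$\lim_{n\to\infty}\frac{Q^{(n+1)}(\lambda)}{Q^{(n)}(\lambda)}=\frac1{r_I(\lambda)}$$ for some root $r_I(\lambda)$ of $\varphi$. Let $r_I(\lambda),r_1(\lambda),\dots,r_N(\lambda)$ be the roots of $\varphi$ listed with multiplicity (not assumed distinct). Then the multiple orthogonal polynomials of type II satisfy the order $N$ homogeneous linear recurrence (for $n\ge N$ with $Q^{(n-1)}(\lambda)\ne0$) $$\Big(\tfrac{Q^{(n)}(\lambda)}{Q^{(n-1)}(\lambda)},\dots,\tfrac{Q^{(n+N-1)}(\lambda)}{Q^{(n-1)}(\lambda)}\Big)\,M_n\begin{pmatrix}B^{(n-N)}(\lambda)\\ \vdots\\ B^{(n-1)}(\lambda)\end{pmatrix}=B^{(n)}(\lambda),$$ where $M_n$ is the $N\times N$ upper triangular matrix with entries $(M_n)_{i,j}=J_{n+i-1,\,n-N+j-1}$ for $1\le i\le j\le N$ and $(M_n)_{i,j}=0$ for $i>j$, and the ratios $Q^{(n+k)}(\lambda)/Q^{(n-1)}(\lambda)$, $k=0,\dots,N-1$, are understood as given. The characteristic polynomial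 of this recurrence is $$\Phi(r)=-\frac{\varphi(r)}{r-r_I(\lambda)}=-(r-r_1(\lambda))\cdots(r-r_N(\lambda)).$$ Thus, if $r_I(\lambda)$ is a root of $\varphi$ of multiplicity $1$, then $r_I(\lambda)$ is not a characteristic root of this order $N$ recurrence, and if it has multiplicity $m>1$, then $r_I(\lambda)$ is a characteristic root of it with multiplicity $m-1$.
   Context: General setting. $\Delta\subset\mathbb R$ is an interval, $\mu$ is a finite Borel measure of constant sign on $\Delta$ whose support has infinitely many points, $w_1,\dots,w_p$ are weights on $\Delta$ (real integrable functions, each of constant sign, possibly also defined at real points outside $\Delta$), all the moments $\int_\Delta x^k w_a\,d\mu$ being finite, and $\vec n=(n_1,\dots,n_p)$ is a vector of positive integers, $|\vec n|=n_1+\dots+n_p$. Every $i\in\mathbb N_0$ is written uniquely as $i=q(i)|\vec n|+n_1+\dots+n_{a(i)-1}+r(i)$ with $q(i)\in\mathbb N_0$, $a(i)\in\{1,\dots,p\}$, $0\le r(i)<n_{a(i)}$; put $k(i)=q(i)n_{a(i)}+r(i)$ and $\xi^{(i)}(x)=x^{k(i)}w_{a(i)}(x)$. The pair $(\mu,\vec w)$ is assumed perfect; in particular all leading principal minors of the moment matrix $g_{i,j}=\int_\Delta x^i\xi^{(j)}(x)\,d\mu(x)$ are nonzero. Then: - $B^{(l)}$ is the unique monic polynomial of degree $l$ with $\int_\Delta B^{(l)}\xi^{(j)}\,d\mu=0$ for $0\le j<l$ (type II multiple orthogonal polynomial); - $Q^{(l)}$ (type I linear form) is the unique real linear combination of the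 functions $\xi^{(0)},\dots,\xi^{(l)}$ (obtained from the Gauss–Borel factorization of $g$) with $\int_\Delta x^iQ^{(l)}(x)\,d\mu(x)=\delta_{i,l}$ for $0\le i\le l$; - the Jacobi matrix $J=(J_{n,m})_{n,m\in\mathbb N_0}$ is defined by $xB^{(n)}(x)=\sum_m J_{n,m}B^{(m)}(x)$. With $N:=\max_a(|\vec n|-n_a+1)$ one has $J_{n,n+1}=1$ and $J_{n,m}=0$ unless $n-N\le m\le n+1$; moreover $J^\top Q(x)=xQ(x)$ for $Q=(Q^{(0)},Q^{(1)},\dots)^\top$. The characteristic polynomial of a linear recurrence $\sum_{i=0}^{N}\alpha_i(n)y_{n+i}=0$ whose coefficients converge, $\alpha_i(n)\to\alpha_i$ as $n\to\infty$, is $\sum_{i=0}^N\alpha_i r^i$ (here the recurrence is written with $B^{(n)}(\lambda)$ moved to the left-hand side with coefficient $-1$); its roots are the characteristic roots. *)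

theory Defs
  imports
    "HOL-Analysis.Analysis"
    "HOL-Computational_Algebra.Fundamental_Theorem_Algebra"
    "Jordan_Normal_Form.Matrix"
begin

text \<open>
  Throughout, \<open>w a\<close> (\<open>1 \<le> a \<le> p\<close>) are the weights and \<open>n a\<close> the entries of the vector
  of positive integers. A Borel measure of constant sign on \<open>\<Delta>\<close> is a positive measure \<open>\<mu>\<close> together
  with a sign \<open>s \<in> {1, -1}\<close>. The weights are total functions on the reals; wherever a weight is
  undefined outside \<open>\<Delta>\<close>, its value there is arbitrary and never constrained.
\<close>

definition signed_integral :: "real \<Rightarrow> real measure \<Rightarrow> (real \<Rightarrow> real) \<Rightarrow> real" where
  "signed_integral s \<mu> f = s * integral\<^sup>L \<mu> f"

definition measure_support :: "real measure \<Rightarrow> real set" where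
  "measure_support \<mu> = {x. \<forall>U. open U \<and> x \<in> U \<longrightarrow> emeasure \<mu> (U \<inter> space \<mu>) > 0}"

text \<open>
  A multi-index \<open>\<nu>\<close> (zero entries allowed) is normal if every nontrivial polynomial of degree at most
  \<open>|\<nu>|\<close> satisfying the type II orthogonality conditions for \<open>\<nu>\<close> has degree exactly \<open>|\<nu>|\<close>.
  The system is perfect if all multi-indices are normal.
\<close>

definition normal_index ::
  "real \<Rightarrow> real measure \<Rightarrow> nat \<Rightarrow> (nat \<Rightarrow> real \<Rightarrow> real) \<Rightarrow> (nat \<Rightarrow> nat) \<Rightarrow> bool" where
  "normal_index s \<mu> p w \<nu> \<longleftrightarrow>
     (\<forall>P :: real poly. P \<noteq> 0 \<longrightarrow> degree P \<le> (\<Sum>a=1..p. \<nu> a) \<longrightarrow>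
        (\<forall>a\<in>{1..p}. \<forall>k<\<nu> a. signed_integral s \<mu> (\<lambda>x. poly P x * (x ^ k * w a x)) = 0) \<longrightarrow>
        degree P = (\<Sum>a=1..p. \<nu> a))"

definition perfect_system ::
  "real \<Rightarrow> real measure \<Rightarrow> nat \<Rightarrow> (nat \<Rightarrow> real \<Rightarrow> real) \<Rightarrow> bool" where
  "perfect_system s \<mu> p w \<longleftrightarrow> (\<forall>\<nu>. normal_index s \<mu> p w \<nu>)"

locale mop_system =
  fixes \<Delta> :: "real set" and s :: real and \<mu> :: "real measure"
    and p :: nat and w :: "nat \<Rightarrow> real \<Rightarrow> real" and n :: "nat \<Rightarrow> nat"
  assumes interval: "is_interval \<Delta>"
    and sets_mu: "sets \<mu> = sets (restrict_space borel \<Delta>)"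
    and finite_mu: "finite_measure \<mu>"
    and sign: "s = 1 \<or> s = - 1"
    and infinite_support: "infinite (measure_support \<mu>)"
    and p_pos: "p \<ge> 1"
    and n_pos: "\<And>a. a \<in> {1..p} \<Longrightarrow> n a > 0"
    and moments: "\<And>a k. a \<in> {1..p} \<Longrightarrow> integrable \<mu> (\<lambda>x. x ^ k * w a x)"
    and weight_sign: "\<And>a. a \<in> {1..p} \<Longrightarrow> (\<forall>x\<in>\<Delta>. w a x \<ge> 0) \<or> (\<forall>x\<in>\<Delta>. w a x \<le> 0)"
    and perfect: "perfect_system s \<mu> p w"

definition index_sum :: "nat \<Rightarrow> (nat \<Rightarrow> nat) \<Rightarrow> nat" where
  "index_sum p n = (\<Sum>a=1..p. n a)"

text \<open>The triple \<open>(q(i), a(i), r(i))\<close>.\<close>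
definition index_decomp :: "nat \<Rightarrow> (nat \<Rightarrow> nat) \<Rightarrow> nat \<Rightarrow> nat \<times> nat \<times> nat" where
  "index_decomp p n i =
     (THE (q, a, r). i = q * index_sum p n + (\<Sum>b=1..<a. n b) + r \<and> a \<in> {1..p} \<and> r < n a)"

definition xi ::
  "nat \<Rightarrow> (nat \<Rightarrow> real \<Rightarrow> real) \<Rightarrow> (nat \<Rightarrow> nat) \<Rightarrow> nat \<Rightarrow> real \<Rightarrow> real" where
  "xi p w n i x = (case index_decomp p n i of (q, a, r) \<Rightarrow> x ^ (q * n a + r) * w a x)"

definition typeII_poly ::
  "real \<Rightarrow> real measure \<Rightarrow> nat \<Rightarrow> (nat \<Rightarrow> real \<Rightarrow> real) \<Rightarrow> (nat \<Rightarrow> nat) \<Rightarrow> nat \<Rightarrow> real poly" where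
  "typeII_poly s \<mu> p w n l =
     (THE P. degree P = l \<and> lead_coeff P = 1 \<and>
        (\<forall>j<l. signed_integral s \<mu> (\<lambda>x. poly P x * xi p w n j x) = 0))"

text \<open>
  The coefficients of the linear form, rather than only its values on \<open>\<Delta>\<close>, are what is unique;
  they determine its values outside \<open>\<Delta>\<close>.
\<close>
definition typeI_coeff ::
  "real \<Rightarrow> real measure \<Rightarrow> nat \<Rightarrow> (nat \<Rightarrow> real \<Rightarrow> real) \<Rightarrow> (nat \<Rightarrow> nat) \<Rightarrow> nat \<Rightarrow> nat \<Rightarrow> real" where
  "typeI_coeff s \<mu> p w n l =
     (THE c. (\<forall>j>l. c j = 0) \<and>
        (\<forall>i\<le>l. signed_integral s \<mu> (\<lambda>x. x ^ i * (\<Sum>j\<le>l. c j * xi p w n j x)) = of_bool (i = l)))"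

definition typeI_form ::
  "real \<Rightarrow> real measure \<Rightarrow> nat \<Rightarrow> (nat \<Rightarrow> real \<Rightarrow> real) \<Rightarrow> (nat \<Rightarrow> nat) \<Rightarrow> nat \<Rightarrow> real \<Rightarrow> real" where
  "typeI_form s \<mu> p w n l x = (\<Sum>j\<le>l. typeI_coeff s \<mu> p w n l j * xi p w n j x)"

text \<open>
  Row \<open>l\<close> of the Jacobi matrix: the coordinates of \<open>x B\<^sup>(\<^sup>l\<^sup>)\<close> in the basis \<open>B\<^sup>(\<^sup>0\<^sup>), B\<^sup>(\<^sup>1\<^sup>), \<dots>\<close>.
\<close>
definition jacobi_matrix ::
  "real \<Rightarrow> real measure \<Rightarrow> nat \<Rightarrow> (nat \<Rightarrow> real \<Rightarrow> real) \<Rightarrow> (nat \<Rightarrow> nat) \<Rightarrow> nat \<Rightarrow> nat \<Rightarrow> real" where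
  "jacobi_matrix s \<mu> p w n l =
     (THE c. finite {m. c m \<noteq> 0} \<and>
        [:0, 1:] * typeII_poly s \<mu> p w n l =
        (\<Sum>m | c m \<noteq> 0. Polynomial.smult (c m) (typeII_poly s \<mu> p w n m)))"

definition band_width :: "nat \<Rightarrow> (nat \<Rightarrow> nat) \<Rightarrow> nat" where
  "band_width p n = Max ((\<lambda>a. index_sum p n - n a + 1) ` {1..p})"

definition phi_poly :: "nat \<Rightarrow> (nat \<Rightarrow> real) \<Rightarrow> real \<Rightarrow> real poly" where
  "phi_poly N c lam = (\<Sum>j=1..N. Polynomial.monom (c j) (N - j)) + Polynomial.monom (c 0 - lam) N + Polynomial.monom 1 (N + 1)"

text \<open>Rows and columns are numbered from 0; only used for \<open>n \<ge> N\<close>.\<close>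
definition corner_matrix :: "nat \<Rightarrow> (nat \<Rightarrow> nat \<Rightarrow> real) \<Rightarrow> nat \<Rightarrow> real mat" where
  "corner_matrix N J n = Matrix.mat N N (\<lambda>(i, j). if i \<le> j then J (n + i) (n - N + j) else 0)"

definition ratio_vec :: "nat \<Rightarrow> (nat \<Rightarrow> real) \<Rightarrow> nat \<Rightarrow> real Matrix.vec" where
  "ratio_vec N y n = Matrix.vec N (\<lambda>k. y (n + k) / y (n - 1))"

text \<open>
  A recurrence \<open>\<Sum>i\<le>N. \<alpha> i n * y (n + i) = 0\<close> is given by its coefficients \<open>\<alpha>\<close>.
  The next definition writes the recurrence expressing \<open>B\<^sup>(\<^sup>n\<^sup>+\<^sup>N\<^sup>)\<close> by
  \<open>B\<^sup>(\<^sup>n\<^sup>), \<dots>, B\<^sup>(\<^sup>n\<^sup>+\<^sup>N\<^sup>-\<^sup>1\<^sup>)\<close> in this form, so its index is shifted by \<open>N\<close>.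
\<close>
definition typeII_rec_coeff ::
  "nat \<Rightarrow> (nat \<Rightarrow> nat \<Rightarrow> real) \<Rightarrow> (nat \<Rightarrow> real) \<Rightarrow> nat \<Rightarrow> nat \<Rightarrow> real" where
  "typeII_rec_coeff N J y i n =
     (if i < N then scalar_prod (ratio_vec N y (n + N)) (col (corner_matrix N J (n + N)) i) else - 1)"

definition rec_char_poly :: "nat \<Rightarrow> (nat \<Rightarrow> nat \<Rightarrow> real) \<Rightarrow> real poly" where
  "rec_char_poly N \<alpha> = (\<Sum>i\<le>N. Polynomial.monom (lim (\<lambda>n. \<alpha> i n)) i)"

end

theory Submission
  imports Defs "Jordan_Normal_Form.Determinant"
begin

text \<open>
  Compute \<open>\<Sum>k<n. x Q\<^sup>(\<^sup>k\<^sup>) B\<^sup>(\<^sup>k\<^sup>)\<close> in two ways, by letting \<open>J\<close> act on \<open>B\<close> and \<open>J\<^sup>T\<close> act on \<open>Q\<close>. The block of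
  \<open>J\<close> with both indices below \<open>n\<close> contributes the same on both sides; because \<open>J\<close> is banded, what is
  left is \<open>Q\<^sup>(\<^sup>n\<^sup>-\<^sup>1\<^sup>) B\<^sup>(\<^sup>n\<^sup>)\<close> on one side and the corner below the diagonal block on the other, which is
  the recurrence. Ratio asymptotics of \<open>Q\<close> turn the coefficients of the recurrence into those of
  Horner's scheme for dividing \<open>\<phi>\<close> by \<open>r - r\<^sub>I\<close>; note that \<open>r\<^sub>I \<noteq> 0\<close>, as \<open>\<phi>\<close> has constant
  term \<open>c\<^sub>N \<noteq> 0\<close>.
\<close>

section \<open>Square linear systems\<close>

text \<open>Nonsingularity of the leading block of size \<open>l\<close> of an infinite matrix. A
  row vector in the kernel will be the coefficient vector of a polynomial, so this is the form in
  which normality supplies it.\<close>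

definition trivial_left_kernel :: "nat \<Rightarrow> (nat \<Rightarrow> nat \<Rightarrow> 'a::field) \<Rightarrow> bool" where
  "trivial_left_kernel l G \<longleftrightarrow>
     (\<forall>v. (\<forall>j<l. (\<Sum>i<l. v i * G i j) = 0) \<longrightarrow> (\<forall>i<l. v i = 0))"

lemma sum_mult_indicator:
  fixes f :: "'b \<Rightarrow> 'a::semiring_1"
  assumes "finite A" "j \<in> A"
  shows "(\<Sum>k\<in>A. f k * of_bool (k = j)) = f j"
proof -
  have "(\<Sum>k\<in>A. f k * of_bool (k = j)) = (\<Sum>k\<in>A. if k = j then f k else 0)"
    by (rule sum.cong) auto
  then show ?thesis
    using assms by simp
qed

text \<open>A vanishing determinant would put a nonzero vector into the kernel of the
  transpose.\<close>

lemma inverse_of_trivial_left_kernel: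
  fixes G :: "nat \<Rightarrow> nat \<Rightarrow> 'a::field"
  assumes "trivial_left_kernel l G"
  shows "\<exists>H. \<forall>i<l. \<forall>k<l. (\<Sum>j<l. G i j * H j k) = of_bool (i = k) \<and>
    (\<Sum>j<l. H i j * G j k) = of_bool (i = k)"
proof -
  define A where "A = Matrix.mat l l (\<lambda>(i, j). G i j)"
  have A: "A \<in> carrier_mat l l"
    by (simp add: A_def)
  have "Determinant.det A \<noteq> 0"
  proof
    assume "Determinant.det A = 0"
    then have "Determinant.det (transpose_mat A) = 0"
      using Determinant.det_transpose[OF A] by simp
    then obtain v where v: "v \<in> carrier_vec l" "v \<noteq> 0\<^sub>v l" "transpose_mat A *\<^sub>v v = 0\<^sub>v l"
      using det_0_iff_vec_prod_zero_field[of "transpose_mat A" l] A by auto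
    have "(\<Sum>i<l. vec_index v i * G i j) = 0" if j: "j < l" for j
    proof -
      have "(\<Sum>i<l. vec_index v i * G i j) = vec_index (transpose_mat A *\<^sub>v v) j"
        using v(1) j by (auto simp: A_def scalar_prod_def lessThan_atLeast0 mult.commute intro!: sum.cong)
      then show "(\<Sum>i<l. vec_index v i * G i j) = 0"
        using v(3) j by simp
    qed
    then have "\<forall>i<l. vec_index v i = 0"
      using assms unfolding trivial_left_kernel_def by blast
    then show False
      using v(1,2) by (auto intro: eq_vecI)
  qed
  from det_non_zero_imp_unit[OF A this, of "()"]
  obtain C where C: "C \<in> carrier_mat l l" "A * C = 1\<^sub>m l" "C * A = 1\<^sub>m l"
    by (auto simp: Units_def ring_mat_def)
  show ?thesis
  proof (intro exI[of _ "\<lambda>i j. C $$ (i, j)"] allI impI conjI)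
    fix i k assume ik: "i < l" "k < l"
    have "(\<Sum>j<l. G i j * C $$ (j, k)) = (A * C) $$ (i, k)"
      using C(1) ik by (auto simp: A_def scalar_prod_def lessThan_atLeast0 intro!: sum.cong)
    then show "(\<Sum>j<l. G i j * C $$ (j, k)) = of_bool (i = k)"
      using C(2) ik by simp
    have "(\<Sum>j<l. C $$ (i, j) * G j k) = (C * A) $$ (i, k)"
      using C(1) ik by (auto simp: A_def scalar_prod_def lessThan_atLeast0 intro!: sum.cong)
    then show "(\<Sum>j<l. C $$ (i, j) * G j k) = of_bool (i = k)"
      using C(3) ik by simp
  qed
qed

text \<open>The solution is the row \<open>b\<close> times the inverse. It will supply the
  coefficients of the type II polynomials.\<close>

lemma left_solution:
  fixes G :: "nat \<Rightarrow> nat \<Rightarrow> 'a::field"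
  assumes "trivial_left_kernel l G"
  shows "\<exists>v. \<forall>j<l. (\<Sum>i<l. v i * G i j) = b j"
proof -
  obtain H where H: "\<forall>i<l. \<forall>k<l. (\<Sum>j<l. H i j * G j k) = of_bool (i = k)"
    using inverse_of_trivial_left_kernel[OF assms(1)] by blast
  show ?thesis
  proof (intro exI allI impI)
    fix j assume j: "j < l"
    have "(\<Sum>i<l. (\<Sum>k<l. b k * H k i) * G i j) = (\<Sum>k<l. b k * (\<Sum>i<l. H k i * G i j))"
      unfolding sum_distrib_left sum_distrib_right by (subst sum.swap) (simp add: mult.assoc)
    also have "\<dots> = (\<Sum>k<l. b k * of_bool (k = j))"
      using H j by (auto intro: sum.cong)
    also have "\<dots> = b j"
      using j by (simp add: sum_mult_indicator)
    finally show "(\<Sum>i<l. (\<Sum>k<l. b k * H k i) * G i j) = b j" .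
  qed
qed

text \<open>The solution is the inverse applied to the column \<open>b\<close>. It will supply the
  coefficients of the type I forms.\<close>

lemma right_solution:
  fixes G :: "nat \<Rightarrow> nat \<Rightarrow> 'a::field"
  assumes "trivial_left_kernel l G"
  shows "\<exists>v. \<forall>i<l. (\<Sum>j<l. v j * G i j) = b i"
proof -
  obtain H where H: "\<forall>i<l. \<forall>k<l. (\<Sum>j<l. G i j * H j k) = of_bool (i = k)"
    using inverse_of_trivial_left_kernel[OF assms(1)] by blast
  show ?thesis
  proof (intro exI allI impI)
    fix i assume i: "i < l"
    have "(\<Sum>j<l. (\<Sum>k<l. b k * H j k) * G i j) = (\<Sum>k<l. b k * (\<Sum>j<l. G i j * H j k))"
      unfolding sum_distrib_left sum_distrib_right
      by (subst sum.swap) (simp add: mult.assoc mult.commute mult.left_commute)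
    also have "\<dots> = (\<Sum>k<l. b k * of_bool (k = i))"
      using H i by (auto intro: sum.cong)
    also have "\<dots> = b i"
      using i by (simp add: sum_mult_indicator)
    finally show "(\<Sum>j<l. (\<Sum>k<l. b k * H j k) * G i j) = b i" .
  qed
qed

text \<open>A left inverse cancels \<open>G\<close>. This is behind the uniqueness of the type I
  coefficients.\<close>

lemma right_kernel_trivial:
  fixes G :: "nat \<Rightarrow> nat \<Rightarrow> 'a::field"
  assumes "trivial_left_kernel l G"
    and v: "\<And>i. i < l \<Longrightarrow> (\<Sum>j<l. v j * G i j) = 0"
    and k: "k < l"
  shows "v k = 0"
proof -
  obtain H where H: "\<forall>i<l. \<forall>k<l. (\<Sum>j<l. H i j * G j k) = of_bool (i = k)"
    using inverse_of_trivial_left_kernel[OF assms(1)] by blast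
  have "0 = (\<Sum>i<l. H k i * (\<Sum>j<l. v j * G i j))"
    using v by simp
  also have "\<dots> = (\<Sum>j<l. v j * (\<Sum>i<l. H k i * G i j))"
    unfolding sum_distrib_left sum_distrib_right
    by (subst sum.swap) (simp add: mult.assoc mult.commute mult.left_commute)
  also have "\<dots> = (\<Sum>j<l. v j * of_bool (j = k))"
    using H k by (auto intro: sum.cong)
  also have "\<dots> = v k"
    using k by (simp add: sum_mult_indicator)
  finally show ?thesis by simp
qed

section \<open>The limiting recurrence\<close>

text \<open>The ratio over \<open>m\<close> steps telescopes into \<open>m\<close> ratios over one
  step.\<close>

lemma tendsto_ratio_power:
  fixes y :: "nat \<Rightarrow> real"
  assumes lim: "(\<lambda>n. y (n + 1) / y n) \<longlonglongrightarrow> z" and "z \<noteq> 0"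
  shows "(\<lambda>n. y (n + m) / y n) \<longlonglongrightarrow> z ^ m"
proof -
  have "\<forall>\<^sub>F n in sequentially. y (n + 1) / y n \<noteq> 0"
    using tendsto_imp_eventually_ne[OF lim \<open>z \<noteq> 0\<close>] .
  \<comment> \<open>Division by 0 gives 0, so a nonzero ratio has a nonzero denominator.\<close>
  then have nonzero: "\<forall>\<^sub>F n in sequentially. y n \<noteq> 0"
    by (rule eventually_mono) auto
  show ?thesis
  proof (induction m)
    case 0
    have "\<forall>\<^sub>F n in sequentially. y (n + 0) / y n = 1"
      using nonzero by (rule eventually_mono) simp
    then show ?case
      by (simp add: tendsto_eventually)
  next
    case (Suc m)
    have "(\<lambda>n. y (n + m + 1) / y (n + m) * (y (n + m) / y n)) \<longlonglongrightarrow> z * z ^ m"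
      by (intro tendsto_mult Suc.IH LIMSEQ_ignore_initial_segment[OF lim])
    \<comment> \<open>Cancelling the middle term requires \<open>y (n + m)\<close> to be nonzero,
      which holds once all terms from \<open>n\<close> on are.\<close>
    moreover have "\<forall>\<^sub>F n in sequentially.
        y (n + m + 1) / y (n + m) * (y (n + m) / y n) = y (n + Suc m) / y n"
      using eventually_ge_at_top[of 0] nonzero eventually_all_ge_at_top[OF nonzero]
      by eventually_elim simp
    ultimately show ?case
      by (simp add: Lim_transform_eventually)
  qed
qed

lemma scalar_prod_ratio_vec:
  assumes "M \<in> carrier_mat N N"
  shows "scalar_prod (ratio_vec N y n) (M *\<^sub>v Matrix.vec N b)
    = (\<Sum>i<N. \<Sum>j<N. y (n + i) / y (n - 1) * (M $$ (i, j) * b j))"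
  using assms by (simp add: ratio_vec_def scalar_prod_def lessThan_atLeast0 sum_distrib_left)

lemma scalar_prod_ratio_vec_col:
  assumes "M \<in> carrier_mat N N" "j < N"
  shows "scalar_prod (ratio_vec N y n) (col M j) = (\<Sum>i<N. y (n + i) / y (n - 1) * M $$ (i, j))"
  using assms by (simp add: ratio_vec_def scalar_prod_def lessThan_atLeast0)

lemma corner_matrix_carrier: "corner_matrix N J n \<in> carrier_mat N N"
  by (simp add: corner_matrix_def)

text \<open>Connects the homogeneous form of the recurrence with its matrix form; the coefficient -1
  at index \<open>N\<close> produces the term \<open>- b (n + N)\<close>.\<close>

lemma typeII_rec_coeff_sum:
  "(\<Sum>i\<le>N. typeII_rec_coeff N J y i n * b (n + i))
    = scalar_prod (ratio_vec N y (n + N)) (corner_matrix N J (n + N) *\<^sub>v Matrix.vec N (\<lambda>j. b (n + j)))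
      - b (n + N)"
proof -
  have "(\<Sum>i\<le>N. typeII_rec_coeff N J y i n * b (n + i))
    = (\<Sum>j<N. (\<Sum>i<N. y (n + N + i) / y (n + N - 1) * corner_matrix N J (n + N) $$ (i, j)) * b (n + j))
      - b (n + N)"
    by (simp add: lessThan_Suc_atMost[symmetric] typeII_rec_coeff_def
        scalar_prod_ratio_vec_col[OF corner_matrix_carrier])
  also have "(\<Sum>j<N. (\<Sum>i<N. y (n + N + i) / y (n + N - 1) * corner_matrix N J (n + N) $$ (i, j)) * b (n + j))
    = (\<Sum>i<N. \<Sum>j<N. y (n + N + i) / y (n + N - 1) * (corner_matrix N J (n + N) $$ (i, j) * b (n + j)))"
    unfolding sum_distrib_right by (subst sum.swap) (simp only: mult.assoc)
  finally show ?thesis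
    by (simp only: scalar_prod_ratio_vec[OF corner_matrix_carrier])
qed

text \<open>Column \<open>i\<close> of the triangular corner has entries only in rows
  \<open>k <= i\<close>. The entry in row \<open>k\<close> lies on the \<open>(N + k - i)\<close>-th
  subdiagonal of \<open>J\<close>, and its weight is a ratio over \<open>Suc k\<close> steps, with
  limit \<open>z ^ Suc k\<close>.\<close>

lemma typeII_rec_coeff_tendsto:
  assumes J: "\<And>j. j \<le> N \<Longrightarrow> (\<lambda>n. J (n + j) n) \<longlonglongrightarrow> c j"
    and y: "(\<lambda>n. y (n + 1) / y n) \<longlonglongrightarrow> z" "z \<noteq> 0"
    and i: "i < N"
  shows "(\<lambda>n. typeII_rec_coeff N J y i n) \<longlonglongrightarrow> (\<Sum>k\<le>i. z ^ Suc k * c (N + k - i))"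
proof -
  \<comment> \<open>Both factors are written as shifts of the given sequences: by
    \<open>N - 1\<close> for the ratios, by \<open>i\<close> along a subdiagonal of
    \<open>J\<close>.\<close>
  have eq: "typeII_rec_coeff N J y i n
      = (\<Sum>k\<le>i. y (n + (N - 1) + Suc k) / y (n + (N - 1)) * J (n + i + (N + k - i)) (n + i))" for n
  proof -
    have corner: "corner_matrix N J (n + N) $$ (k, i) = (if k \<le> i then J (n + N + k) (n + i) else 0)"
      if "k < N" for k
      using that i by (simp add: corner_matrix_def)
    have "typeII_rec_coeff N J y i n
        = (\<Sum>k<N. y (n + N + k) / y (n + N - 1) * (if k \<le> i then J (n + N + k) (n + i) else 0))"
      using i corner by (simp add: typeII_rec_coeff_def scalar_prod_ratio_vec_col[OF corner_matrix_carrier])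
    also have "\<dots> = (\<Sum>k\<le>i. y (n + N + k) / y (n + N - 1) * (if k \<le> i then J (n + N + k) (n + i) else 0))"
      using i by (intro sum.mono_neutral_right) auto
    also have "\<dots> = (\<Sum>k\<le>i. y (n + (N - 1) + Suc k) / y (n + (N - 1)) * J (n + i + (N + k - i)) (n + i))"
      using i by (intro sum.cong) (auto simp: add.commute add.left_commute)
    finally show ?thesis .
  qed
  show ?thesis
    unfolding eq using i
    by (intro tendsto_sum tendsto_mult
        LIMSEQ_ignore_initial_segment[OF tendsto_ratio_power[OF y]]
        LIMSEQ_ignore_initial_segment[OF J]) auto
qed

section \<open>Division of \<open>\<phi>\<close> by a linear factor\<close>

lemma coeff_phi_poly:
  "coeff (phi_poly N c lam) k =
    (if k < N then c (N - k) else if k = N then c 0 - lam else if k = Suc N then 1 else 0)"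
proof -
  have "(\<Sum>j=1..N. coeff (Polynomial.monom (c j) (N - j)) k) = (\<Sum>j=1..N. if j = N - k then (if k < N then c j else 0) else 0)"
    by (rule sum.cong) auto
  then have "(\<Sum>j=1..N. coeff (Polynomial.monom (c j) (N - j)) k) = (if k < N then c (N - k) else 0)"
    by (simp add: sum.delta') arith
  then show ?thesis
    by (auto simp: phi_poly_def coeff_sum)
qed

lemma degree_phi_poly: "degree (phi_poly N c lam) = Suc N"
  by (rule antisym) (auto intro!: degree_le le_degree simp: coeff_phi_poly)

text \<open>
  \<open>low\<close> is Horner's scheme for dividing by \<open>[:- rI, 1:]\<close> from the constant term upwards. It yields every
  coefficient of the identity except the one at \<open>N\<close>, and that one follows since \<open>rI\<close> is a root.
\<close>
lemma phi_poly_factor: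
  fixes \<Phi> :: "real poly"
  assumes root: "poly (phi_poly N c lam) rI = 0" and "rI \<noteq> 0"
    and low: "\<And>i. i < N \<Longrightarrow> coeff \<Phi> i = (\<Sum>k\<le>i. (1 / rI) ^ Suc k * c (N + k - i))"
    and high: "coeff \<Phi> N = - 1" "\<And>i. i > N \<Longrightarrow> coeff \<Phi> i = 0"
  shows "phi_poly N c lam = [:- rI, 1:] * - \<Phi>"
proof -
  define D where "D = phi_poly N c lam + [:- rI, 1:] * \<Phi>"
  have D: "coeff D k = coeff (phi_poly N c lam) k + (case k of 0 \<Rightarrow> 0 | Suc m \<Rightarrow> coeff \<Phi> m) - rI * coeff \<Phi> k" for k
    by (simp add: D_def coeff_pCons split: nat.split)
  have "coeff D k = 0" if k: "k \<noteq> N" for k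
  proof (cases k)
    case 0
    then show ?thesis
      using k \<open>rI \<noteq> 0\<close> by (simp add: D low coeff_phi_poly)
  next
    case (Suc m)
    consider "k < N" | "k = Suc N" | "k > Suc N"
      using k by linarith
    then show ?thesis
    proof cases
      case 1
      \<comment> \<open>One Horner step: the summand \<open>k = 0\<close> is split off, and
        reindexing turns the rest into the coefficient at \<open>m\<close>.\<close>
      have "rI * coeff \<Phi> (Suc m) = c (N - Suc m) + (\<Sum>k\<le>m. (1 / rI) ^ Suc k * c (N + k - m))"
        using 1 Suc \<open>rI \<noteq> 0\<close>
        by (simp add: low sum.atMost_Suc_shift distrib_left sum_distrib_left del: sum.atMost_Suc)
      then show ?thesis
        using 1 Suc by (simp add: D low coeff_phi_poly del: sum.atMost_Suc)
    qed (use Suc high in \<open>auto simp: D coeff_phi_poly\<close>)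
  qed
  \<comment> \<open>Only a monomial is left, and a monomial with a nonzero root vanishes.\<close>
  then have D_monom: "D = Polynomial.monom (coeff D N) N"
    by (intro poly_eqI) auto
  have "poly D rI = 0"
    using root by (simp add: D_def)
  then have "coeff D N = 0"
    using \<open>rI \<noteq> 0\<close> by (subst (asm) D_monom) (simp add: poly_monom)
  then have "D = 0"
    using D_monom by simp
  then show ?thesis
    by (simp add: D_def add_eq_0_iff2)
qed

lemma map_poly_of_real_mult:
  "map_poly complex_of_real (P * R) = map_poly complex_of_real P * map_poly complex_of_real R"
  by (intro poly_eqI) (simp add: coeff_map_poly coeff_mult)

text \<open>Over the complex numbers the monic \<open>\<phi>\<close> is the product of the linear
  factors of its roots; cancelling the factor of \<open>x\<close> leaves those of
  \<open>- \<Phi>\<close>.\<close>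

lemma complex_factorization_of_linear_factor:
  assumes \<phi>: "\<phi> = [:- x, 1:] * - \<Phi>" and monic: "lead_coeff \<phi> = 1"
    and roots: "proots (map_poly complex_of_real \<phi>)
           = add_mset (complex_of_real x) (image_mset r (mset_set {1..N}))"
  shows "map_poly complex_of_real \<Phi> = - (\<Prod>i=1..N. [:- r i, 1:])"
proof -
  let ?h = "map_poly complex_of_real"
  have "lead_coeff (?h \<phi>) = 1"
    using monic by (simp add: degree_map_poly coeff_map_poly)
  then have "?h \<phi> = (\<Prod>z\<in>#proots (?h \<phi>). [:- z, 1:])"
    using complex_poly_decompose_multiset[of "?h \<phi>"] by simp
  also have "\<dots> = [:- complex_of_real x, 1:] * (\<Prod>i=1..N. [:- r i, 1:])"
    unfolding roots by (simp add: prod_unfold_prod_mset image_mset.compositionality o_def)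
  finally have "?h \<phi> = [:- complex_of_real x, 1:] * (\<Prod>i=1..N. [:- r i, 1:])" .
  moreover have "?h \<phi> = [:- complex_of_real x, 1:] * - ?h \<Phi>"
  proof -
    have "?h (- \<Phi>) = - ?h \<Phi>"
      by (intro poly_eqI) (simp add: coeff_map_poly)
    then show ?thesis
      unfolding \<phi> map_poly_of_real_mult by (simp add: map_poly_pCons)
  qed
  ultimately have "- ?h \<Phi> = (\<Prod>i=1..N. [:- r i, 1:])"
    by (metis mult_left_cancel pCons_eq_0_iff zero_neq_one)
  then show ?thesis
    by (metis minus_minus)
qed

section \<open>Multiple orthogonal polynomials and their Jacobi matrix\<close>

context mop_system
begin

section \<open>Indices as pairs of a weight and a power\<close>

definition block_start :: "nat \<Rightarrow> nat" where
  "block_start a = (\<Sum>b=1..<a. n b)"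

text \<open>The inverse of the map sending \<open>i\<close> to \<open>(a(i), k(i))\<close>: the
  position of \<open>x ^ k * w a x\<close> among the functions \<open>xi\<close>.\<close>

definition weight_index :: "nat \<Rightarrow> nat \<Rightarrow> nat" where
  "weight_index a k = k div n a * index_sum p n + block_start a + k mod n a"

lemma block_start_Suc: "a \<ge> 1 \<Longrightarrow> block_start (Suc a) = block_start a + n a"
  by (simp add: block_start_def)

lemma block_start_last: "block_start (Suc p) = index_sum p n"
  unfolding block_start_def index_sum_def by (rule sum.cong) auto

lemma block_start_mono: "a \<le> b \<Longrightarrow> block_start a \<le> block_start b"
  unfolding block_start_def by (intro sum_mono2) auto

lemma block_end_le: "a \<in> {1..p} \<Longrightarrow> block_start a + n a \<le> index_sum p n"
  using block_start_mono[of "Suc a" "Suc p"] by (simp add: block_start_Suc block_start_last)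

text \<open>The blocks are consecutive half-open intervals, so distinct ones are disjoint.\<close>

lemma block_unique:
  assumes "a \<in> {1..p}" "b \<in> {1..p}" "r < n a" "t < n b"
    and "block_start a + r = block_start b + t"
  shows "a = b"
proof -
  have "block_start (Suc a) \<le> block_start b" if "a < b" for a b
    using that by (intro block_start_mono) simp
  then show ?thesis
    using assms block_start_Suc[of a] block_start_Suc[of b]
    by (metis add_leD1 atLeastAtMost_iff leD le_add1 linorder_neqE_nat nat_add_left_cancel_less order_less_le_trans)
qed

lemma block_exists:
  assumes "m < index_sum p n"
  obtains a r where "a \<in> {1..p}" "r < n a" "m = block_start a + r"
proof -
  define a where "a = (LEAST a. m < block_start (Suc a))"
  have last: "m < block_start (Suc p)"
    using assms block_start_last by simp
  have a: "m < block_start (Suc a)"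
    unfolding a_def by (rule LeastI[of "\<lambda>a. m < block_start (Suc a)", OF last])
  have "a \<le> p"
    unfolding a_def by (rule Least_le[of "\<lambda>a. m < block_start (Suc a)", OF last])
  \<comment> \<open>\<open>block_start 1\<close> is an empty sum, and no natural number lies below
    0.\<close>
  have "a \<noteq> 0"
    using a by (metis block_start_def atLeastLessThan_empty less_nat_zero_code One_nat_def order_refl sum.empty)
  then have "\<not> m < block_start (Suc (a - 1))"
    unfolding a_def by (intro not_less_Least) simp
  then have "block_start a \<le> m"
    using \<open>a \<noteq> 0\<close> by simp
  then show thesis
    using a \<open>a \<noteq> 0\<close> \<open>a \<le> p\<close> block_start_Suc[of a] by (intro that[of a "m - block_start a"]) auto
qed

lemma index_decomp_eq:
  assumes a: "a \<in> {1..p}" and r: "r < n a"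
  shows "index_decomp p n (q * index_sum p n + block_start a + r) = (q, a, r)"
  unfolding index_decomp_def
proof (rule the_equality)
  show "case (q, a, r) of (q', a', r') \<Rightarrow>
      q * index_sum p n + block_start a + r = q' * index_sum p n + (\<Sum>b=1..<a'. n b) + r'
      \<and> a' \<in> {1..p} \<and> r' < n a'"
    using a r by (simp add: block_start_def)
next
  fix z assume "case z of (q', a', r') \<Rightarrow>
      q * index_sum p n + block_start a + r = q' * index_sum p n + (\<Sum>b=1..<a'. n b) + r'
      \<and> a' \<in> {1..p} \<and> r' < n a'"
  then obtain q' a' r' where z: "z = (q', a', r')" and a': "a' \<in> {1..p}" and r': "r' < n a'"
    and eq: "block_start a + r + index_sum p n * q = block_start a' + r' + index_sum p n * q'"
    by (auto simp: block_start_def mult.commute add.assoc add.commute add.left_commute)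
  have lt: "block_start a + r < index_sum p n" "block_start a' + r' < index_sum p n"
    using block_end_le[OF a] block_end_le[OF a'] r r' by auto
  \<comment> \<open>Both remainders lie below \<open>index_sum p n\<close>, so division by it
    recovers the quotient.\<close>
  have "q = q'"
    using arg_cong[OF eq, of "\<lambda>x. x div index_sum p n"] lt by simp
  moreover from this have "block_start a + r = block_start a' + r'"
    using eq by simp
  moreover from this have "a = a'"
    using block_unique a a' r r' by blast
  ultimately show "z = (q, a, r)"
    using z by simp
qed

lemma xi_weight_index:
  assumes "a \<in> {1..p}"
  shows "xi p w n (weight_index a k) x = x ^ k * w a x"
  using index_decomp_eq[OF assms, of "k mod n a" "k div n a"] n_pos[OF assms]
  by (simp add: xi_def weight_index_def)

lemma weight_index_exists:
  obtains a k where "a \<in> {1..p}" "i = weight_index a k"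
proof -
  have "index_sum p n > 0"
    using block_end_le[of 1] n_pos[of 1] p_pos by force
  then obtain a r where a: "a \<in> {1..p}" "r < n a" "i mod index_sum p n = block_start a + r"
    by (metis block_exists mod_less_divisor)
  have "i = i div index_sum p n * index_sum p n + (block_start a + r)"
    using a(3) by (metis div_mult_mod_eq)
  then have "i = weight_index a (i div index_sum p n * n a + r)"
    using a(2) by (simp add: weight_index_def)
  then show thesis
    using that a(1) by blast
qed

lemma weight_index_inj:
  assumes "a \<in> {1..p}" "b \<in> {1..p}" "weight_index a k = weight_index b m"
  shows "a = b \<and> k = m"
proof -
  have "index_decomp p n (weight_index a k) = (k div n a, a, k mod n a)" if "a \<in> {1..p}" for a k
    unfolding weight_index_def using that n_pos by (intro index_decomp_eq) auto
  then have "(k div n a, a, k mod n a) = (m div n b, b, m mod n b)"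
    using assms by metis
  then show ?thesis
    by (metis div_mult_mod_eq prod.inject)
qed

text \<open>Within a block the next power sits at the next index. After the last entry of its block
  it must jump over the blocks of all other weights, a step of
  \<open>index_sum p n - n a + 1\<close>; \<open>band_width\<close> is the largest such
  step.\<close>

lemma weight_index_Suc:
  assumes "a \<in> {1..p}"
  shows "weight_index a k < weight_index a (Suc k)"
    and "weight_index a (Suc k) \<le> weight_index a k + band_width p n"
proof -
  have na: "n a > 0" "n a \<le> index_sum p n"
    using n_pos[OF assms] block_end_le[OF assms] by auto
  have N: "index_sum p n - n a + 1 \<le> band_width p n"
    unfolding band_width_def using assms by (intro Max_ge) auto
  have step: "weight_index a (Suc k) =
    weight_index a k + (if Suc (k mod n a) = n a then index_sum p n - n a + 1 else 1)"
  proof (cases "Suc (k mod n a) = n a")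
    case True
    then have "Suc k div n a = Suc (k div n a)" "Suc k mod n a = 0"
      by (auto simp: div_Suc mod_Suc)
    then show ?thesis
      using True na by (simp add: weight_index_def)
  next
    case False
    then have "Suc k div n a = k div n a" "Suc k mod n a = Suc (k mod n a)"
      by (auto simp: div_Suc mod_Suc)
    then show ?thesis
      using False by (simp add: weight_index_def)
  qed
  show "weight_index a k < weight_index a (Suc k)"
    using step by simp
  show "weight_index a (Suc k) \<le> weight_index a k + band_width p n"
    using step N by (simp split: if_splits)
qed

lemma weight_index_strict_mono: "a \<in> {1..p} \<Longrightarrow> strict_mono (weight_index a)"
  by (simp add: strict_mono_Suc_iff weight_index_Suc)

text \<open>Multiplication by \<open>x\<close> keeps the weight and raises the power by one. This is
  where the lower band of \<open>J\<close> comes from.\<close>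

lemma mult_xi:
  "\<exists>j. j \<le> i + band_width p n \<and> (\<forall>x. x * xi p w n i x = xi p w n j x)"
proof -
  obtain a k where a: "a \<in> {1..p}" and i: "i = weight_index a k"
    by (rule weight_index_exists)
  show ?thesis
    using weight_index_Suc(2)[OF a, of k]
    by (intro exI[of _ "weight_index a (Suc k)"]) (simp add: i xi_weight_index[OF a])
qed

section \<open>The pairing of polynomials with linear forms\<close>

text \<open>The integral of a non-integrable function is 0 by convention, so the pairing is known to
  be additive only where integrability is known.\<close>

definition moment_finite :: "(real \<Rightarrow> real) \<Rightarrow> bool" where
  "moment_finite f \<longleftrightarrow> (\<forall>P. integrable \<mu> (\<lambda>x. poly P x * f x))"

definition pairing :: "real poly \<Rightarrow> (real \<Rightarrow> real) \<Rightarrow> real" where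
  "pairing P f = signed_integral s \<mu> (\<lambda>x. poly P x * f x)"

lemma moment_finite_sum:
  assumes "\<And>i. i \<in> I \<Longrightarrow> moment_finite (f i)"
  shows "moment_finite (\<lambda>x. \<Sum>i\<in>I. c i * f i x)"
  unfolding moment_finite_def
proof
  fix P
  have "integrable \<mu> (\<lambda>x. \<Sum>i\<in>I. c i * (poly P x * f i x))"
    using assms by (intro Bochner_Integration.integrable_sum integrable_mult_right) (auto simp: moment_finite_def)
  then show "integrable \<mu> (\<lambda>x. poly P x * (\<Sum>i\<in>I. c i * f i x))"
    by (simp add: sum_distrib_left mult.left_commute)
qed

lemma moment_finite_xi: "moment_finite (xi p w n i)"
  unfolding moment_finite_def
proof
  fix P
  obtain a k where a: "a \<in> {1..p}" and i: "i = weight_index a k"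
    by (rule weight_index_exists)
  have "integrable \<mu> (\<lambda>x. \<Sum>m\<le>degree P. coeff P m * (x ^ (m + k) * w a x))"
    using moments[OF a] by (intro Bochner_Integration.integrable_sum integrable_mult_right)
  then show "integrable \<mu> (\<lambda>x. poly P x * xi p w n i x)"
    by (simp add: i xi_weight_index[OF a] poly_altdef sum_distrib_right power_add mult.assoc)
qed

lemma pairing_sum_left:
  assumes "moment_finite f"
  shows "pairing (\<Sum>i\<in>I. Polynomial.smult (c i) (P i)) f = (\<Sum>i\<in>I. c i * pairing (P i) f)"
proof -
  have "(\<integral>x. poly (\<Sum>i\<in>I. Polynomial.smult (c i) (P i)) x * f x \<partial>\<mu>)
      = (\<integral>x. (\<Sum>i\<in>I. c i * (poly (P i) x * f x)) \<partial>\<mu>)"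
    by (simp add: poly_sum sum_distrib_right mult.assoc)
  also have "\<dots> = (\<Sum>i\<in>I. c i * (\<integral>x. poly (P i) x * f x \<partial>\<mu>))"
    using assms by (subst Bochner_Integration.integral_sum) (auto simp: moment_finite_def)
  finally show ?thesis
    by (simp add: pairing_def signed_integral_def sum_distrib_left mult.left_commute)
qed

lemma pairing_sum_right:
  assumes "\<And>i. i \<in> I \<Longrightarrow> moment_finite (f i)"
  shows "pairing P (\<lambda>x. \<Sum>i\<in>I. c i * f i x) = (\<Sum>i\<in>I. c i * pairing P (f i))"
proof -
  have "(\<integral>x. poly P x * (\<Sum>i\<in>I. c i * f i x) \<partial>\<mu>)
      = (\<integral>x. (\<Sum>i\<in>I. c i * (poly P x * f i x)) \<partial>\<mu>)"
    by (simp add: sum_distrib_left mult.left_commute)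
  also have "\<dots> = (\<Sum>i\<in>I. c i * (\<integral>x. poly P x * f i x \<partial>\<mu>))"
    using assms by (subst Bochner_Integration.integral_sum) (auto simp: moment_finite_def)
  finally show ?thesis
    by (simp add: pairing_def signed_integral_def sum_distrib_left mult.left_commute)
qed

lemma pairing_add_left: "moment_finite f \<Longrightarrow> pairing (P + R) f = pairing P f + pairing R f"
  by (simp add: pairing_def signed_integral_def moment_finite_def distrib_left distrib_right)

lemma pairing_diff_left: "moment_finite f \<Longrightarrow> pairing (P - R) f = pairing P f - pairing R f"
  by (simp add: pairing_def signed_integral_def moment_finite_def left_diff_distrib right_diff_distrib)

text \<open>Multiplication by \<open>x\<close> is symmetric for the pairing; hence the matrix acting
  on the polynomials acts transposed on the forms.\<close>

lemma pairing_mult_x: "pairing ([:0, 1:] * P) f = pairing P (\<lambda>x. x * f x)"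
  by (simp add: pairing_def mult.assoc mult.left_commute)

lemma pairing_monoms:
  assumes "moment_finite f" "degree P \<le> d"
  shows "pairing P f = (\<Sum>i\<le>d. coeff P i * pairing (Polynomial.monom 1 i) f)"
proof -
  have "P = (\<Sum>i\<le>d. Polynomial.smult (coeff P i) (Polynomial.monom 1 i))"
    using poly_as_sum_of_monoms'[OF assms(2)] by (simp add: smult_monom)
  then show ?thesis
    using pairing_sum_left[OF assms(1)] by metis
qed

text \<open>
  The first \<open>l\<close> functions \<open>\<xi>\<close> are the \<open>x ^ k * w a\<close> with \<open>k < \<nu> a\<close>, where
  \<open>\<nu> a\<close> counts the indices below \<open>l\<close> belonging to the weight \<open>a\<close>; so normality of
  \<open>\<nu>\<close> is what is needed.
\<close>
lemma degree_eq_of_orthogonal: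
  assumes P: "P \<noteq> 0" "degree P \<le> l" and orth: "\<And>j. j < l \<Longrightarrow> pairing P (xi p w n j) = 0"
  shows "degree P = l"
proof -
  define \<nu> where "\<nu> a = (LEAST k. l \<le> weight_index a k)" for a
  have nu: "k < \<nu> a \<longleftrightarrow> weight_index a k < l" if a: "a \<in> {1..p}" for a k
  proof
    assume "k < \<nu> a"
    then show "weight_index a k < l"
      using not_less_Least[of k] unfolding \<nu>_def by fastforce
  next
    assume less: "weight_index a k < l"
    \<comment> \<open>A witness for the \<open>LEAST\<close> in the definition of
      \<open>\<nu>\<close>.\<close>
    have "l \<le> weight_index a l"
      using strict_mono_imp_increasing[OF weight_index_strict_mono[OF a]] .
    then have "l \<le> weight_index a (\<nu> a)"
      unfolding \<nu>_def by (rule LeastI)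
    with less show "k < \<nu> a"
      using strict_mono_less[OF weight_index_strict_mono[OF a]] by (metis order_less_le_trans)
  qed
  \<comment> \<open>Counting both sides of this bijection gives \<open>l\<close> as the size of
    \<open>\<nu>\<close>.\<close>
  have "bij_betw (\<lambda>(a, k). weight_index a k) (SIGMA a:{1..p}. {..<\<nu> a}) {..<l}"
    unfolding bij_betw_def
  proof
    show "inj_on (\<lambda>(a, k). weight_index a k) (SIGMA a:{1..p}. {..<\<nu> a})"
    proof (rule inj_onI, clarify)
      fix a k b m
      assume "a \<in> {1..p}" "b \<in> {1..p}" "weight_index a k = weight_index b m"
      then show "a = b \<and> k = m"
        by (rule weight_index_inj)
    qed
    show "(\<lambda>(a, k). weight_index a k) ` (SIGMA a:{1..p}. {..<\<nu> a}) = {..<l}"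
    proof (intro equalityI subsetI)
      fix i assume "i \<in> {..<l}"
      moreover obtain a k where "a \<in> {1..p}" "i = weight_index a k"
        by (rule weight_index_exists)
      ultimately show "i \<in> (\<lambda>(a, k). weight_index a k) ` (SIGMA a:{1..p}. {..<\<nu> a})"
        using nu by (intro image_eqI[of _ _ "(a, k)"]) auto
    qed (use nu in auto)
  qed
  then have card: "(\<Sum>a=1..p. \<nu> a) = l"
    using bij_betw_same_card by fastforce
  have "pairing P (\<lambda>x. x ^ k * w a x) = 0" if "a \<in> {1..p}" "k < \<nu> a" for a k
    using orth[of "weight_index a k"] nu[OF that(1)] that(2)
    by (simp add: pairing_def xi_weight_index[OF that(1)])
  then show ?thesis
    using perfect P card unfolding perfect_system_def normal_index_def pairing_def by blast
qed

text \<open>A nonzero kernel vector would be the coefficient vector of a polynomial of degree below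
  \<open>l\<close> orthogonal to the first \<open>l\<close> functions \<open>xi\<close>, while
  normality forces degree exactly \<open>l\<close>.\<close>

lemma moment_kernel_trivial:
  "trivial_left_kernel l (\<lambda>i j. pairing (Polynomial.monom 1 i) (xi p w n j))"
  unfolding trivial_left_kernel_def
proof (rule allI, rule impI, rule ccontr)
  fix v :: "nat \<Rightarrow> real"
  assume orth: "\<forall>j<l. (\<Sum>i<l. v i * pairing (Polynomial.monom 1 i) (xi p w n j)) = 0"
  assume "\<not> (\<forall>i<l. v i = 0)"
  then obtain i where i: "i < l" "v i \<noteq> 0"
    by auto
  define P where "P = (\<Sum>i<l. Polynomial.smult (v i) (Polynomial.monom 1 i))"
  have coeff: "coeff P k = (if k < l then v k else 0)" for k
    by (simp add: P_def coeff_sum if_distrib cong: if_cong)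
  have "P \<noteq> 0"
    using i coeff[of i] by auto
  have "degree P < l"
    using i coeff by (intro degree_lessI) auto
  moreover have "degree P = l"
    using \<open>P \<noteq> 0\<close> \<open>degree P < l\<close> orth
    by (intro degree_eq_of_orthogonal) (auto simp: P_def pairing_sum_left moment_finite_xi)
  ultimately show False
    by simp
qed

section \<open>Existence, uniqueness and biorthogonality of \<open>B\<close> and
  \<open>Q\<close>\<close>

text \<open>With the leading term fixed, the lower coefficients solve a nonsingular system. The
  difference of two solutions loses its leading term, yet normality would give it degree
  \<open>l\<close> if it were nonzero.\<close>

lemma typeII_poly_ex1:
  "\<exists>!P. degree P = l \<and> lead_coeff P = 1 \<and>
     (\<forall>j<l. signed_integral s \<mu> (\<lambda>x. poly P x * xi p w n j x) = 0)"
proof -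
  obtain v where v: "\<And>j. j < l \<Longrightarrow> (\<Sum>i<l. v i * pairing (Polynomial.monom 1 i) (xi p w n j))
      = - pairing (Polynomial.monom 1 l) (xi p w n j)"
    using left_solution[OF moment_kernel_trivial[of l],
        where b = "\<lambda>j. - pairing (Polynomial.monom 1 l) (xi p w n j)"] by blast
  define R where "R = (\<Sum>i<l. Polynomial.smult (v i) (Polynomial.monom 1 i))"
  have coeff: "coeff (Polynomial.monom 1 l + R) k = (if k < l then v k else of_bool (k = l))" for k
    by (auto simp: R_def coeff_sum if_distrib cong: if_cong)
  have deg: "degree (Polynomial.monom 1 l + R) = l"
    by (rule antisym) (auto intro!: degree_le le_degree simp: coeff simp del: coeff_add)
  have ex: "degree (Polynomial.monom 1 l + R) = l \<and> lead_coeff (Polynomial.monom 1 l + R) = 1 \<and>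
     (\<forall>j<l. signed_integral s \<mu> (\<lambda>x. poly (Polynomial.monom 1 l + R) x * xi p w n j x) = 0)"
    unfolding pairing_def[symmetric] deg
  proof (intro conjI refl allI impI)
    show "coeff (Polynomial.monom 1 l + R) l = 1"
      by (subst coeff) simp
  next
    fix j assume "j < l"
    then show "pairing (Polynomial.monom 1 l + R) (xi p w n j) = 0"
      using v by (simp add: pairing_add_left R_def pairing_sum_left moment_finite_xi)
  qed
  show ?thesis
  proof (rule ex_ex1I)
    fix P P' :: "real poly"
    assume P: "degree P = l \<and> lead_coeff P = 1 \<and>
        (\<forall>j<l. signed_integral s \<mu> (\<lambda>x. poly P x * xi p w n j x) = 0)"
      and P': "degree P' = l \<and> lead_coeff P' = 1 \<and>
        (\<forall>j<l. signed_integral s \<mu> (\<lambda>x. poly P' x * xi p w n j x) = 0)"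
    show "P = P'"
    proof (rule ccontr)
      assume "P \<noteq> P'"
      then have "degree (P - P') = l"
        using P P' by (intro degree_eq_of_orthogonal)
          (auto intro: degree_diff_le simp: pairing_diff_left moment_finite_xi, auto simp: pairing_def)
      moreover have "coeff (P - P') l = 0"
        using P P' by auto
      ultimately have "P - P' = 0"
        using leading_coeff_0_iff by metis
      then show False
        using \<open>P \<noteq> P'\<close> by simp
    qed
  qed (use ex in blast)
qed

abbreviation B :: "nat \<Rightarrow> real poly" where
  "B \<equiv> typeII_poly s \<mu> p w n"

lemma degree_B: "degree (B l) = l"
  and lead_coeff_B: "coeff (B l) l = 1"
  and B_orthogonal: "j < l \<Longrightarrow> pairing (B l) (xi p w n j) = 0"
  using theI'[OF typeII_poly_ex1, of l] unfolding typeII_poly_def[symmetric]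
  by (auto simp: pairing_def)

text \<open>Linear independence tested by moments. It speaks of coefficients because these also
  govern the values off the interval.\<close>

lemma xi_sum_trivial:
  assumes "\<And>i. i < l \<Longrightarrow> pairing (Polynomial.monom 1 i) (\<lambda>x. \<Sum>j<l. c j * xi p w n j x) = 0"
  shows "j < l \<Longrightarrow> c j = 0"
  using assms by (intro right_kernel_trivial[OF moment_kernel_trivial, where v = c])
    (auto simp: pairing_sum_right moment_finite_xi)

text \<open>The conditions form a nonsingular square system of size \<open>Suc l\<close>; requiring
  zeros beyond \<open>l\<close> makes the coefficients unique as a function on all naturals.\<close>

lemma typeI_coeff_ex1:
  "\<exists>!c. (\<forall>j>l. c j = 0) \<and>
     (\<forall>i\<le>l. signed_integral s \<mu> (\<lambda>x. x ^ i * (\<Sum>j\<le>l. c j * xi p w n j x)) = of_bool (i = l))"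
proof -
  have pair: "signed_integral s \<mu> (\<lambda>x. x ^ i * (\<Sum>j\<le>l. c j * xi p w n j x))
      = (\<Sum>j<Suc l. c j * pairing (Polynomial.monom 1 i) (xi p w n j))" for c i
    using pairing_sum_right[of "{..l}" "xi p w n" "Polynomial.monom 1 i" c, OF moment_finite_xi]
    by (simp add: pairing_def poly_monom lessThan_Suc_atMost del: sum.lessThan_Suc)
  obtain v where v: "\<And>i. i < Suc l \<Longrightarrow>
      (\<Sum>j<Suc l. v j * pairing (Polynomial.monom 1 i) (xi p w n j)) = of_bool (i = l)"
    using right_solution[OF moment_kernel_trivial[of "Suc l"], where b = "\<lambda>i. of_bool (i = l)"] by blast
  show ?thesis
    unfolding pair
  proof (rule ex_ex1I)
    show "\<exists>c. (\<forall>j>l. c j = 0) \<and>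
        (\<forall>i\<le>l. (\<Sum>j<Suc l. c j * pairing (Polynomial.monom 1 i) (xi p w n j)) = of_bool (i = l))"
      using v by (intro exI[of _ "\<lambda>j. if j < Suc l then v j else 0"]) (auto cong: if_cong)
  next
    fix c c' :: "nat \<Rightarrow> real"
    assume c: "(\<forall>j>l. c j = 0) \<and>
        (\<forall>i\<le>l. (\<Sum>j<Suc l. c j * pairing (Polynomial.monom 1 i) (xi p w n j)) = of_bool (i = l))"
      and c': "(\<forall>j>l. c' j = 0) \<and>
        (\<forall>i\<le>l. (\<Sum>j<Suc l. c' j * pairing (Polynomial.monom 1 i) (xi p w n j)) = of_bool (i = l))"
    show "c = c'"
    proof
      fix j
      have "c j - c' j = 0" if "j < Suc l"
      proof (rule right_kernel_trivial[OF moment_kernel_trivial _ that])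
        fix i assume "i < Suc l"
        then show "(\<Sum>j<Suc l. (c j - c' j) * pairing (Polynomial.monom 1 i) (xi p w n j)) = 0"
          using c c' by (simp add: left_diff_distrib sum_subtractf del: sum.lessThan_Suc)
      qed
      then show "c j = c' j"
        using c c' by (cases "j < Suc l") auto
    qed
  qed
qed

abbreviation Q :: "nat \<Rightarrow> real \<Rightarrow> real" where
  "Q \<equiv> typeI_form s \<mu> p w n"

lemma Q_eq: "Q l = (\<lambda>x. \<Sum>j\<le>l. typeI_coeff s \<mu> p w n l j * xi p w n j x)"
  by (simp add: typeI_form_def fun_eq_iff)

lemma moment_finite_Q: "moment_finite (Q l)"
  unfolding Q_eq by (intro moment_finite_sum moment_finite_xi)

lemma pairing_monom_Q: "i \<le> l \<Longrightarrow> pairing (Polynomial.monom 1 i) (Q l) = of_bool (i = l)"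
  using theI'[OF typeI_coeff_ex1, of l] unfolding typeI_coeff_def[symmetric]
  by (simp add: pairing_def poly_monom Q_eq)

text \<open>The moments of \<open>Q l\<close> below \<open>l\<close> vanish and the one at
  \<open>l\<close> is 1, so only the top coefficient survives.\<close>

lemma pairing_Q: "degree P \<le> l \<Longrightarrow> pairing P (Q l) = coeff P l"
  by (simp add: pairing_monoms[OF moment_finite_Q] pairing_monom_Q)

text \<open>For \<open>k <= l\<close> the pairing reads off a coefficient of \<open>B k\<close>; for
  \<open>k > l\<close> the polynomial \<open>B k\<close> is orthogonal to every \<open>xi\<close>
  occurring in \<open>Q l\<close>.\<close>

lemma biorthogonal: "pairing (B k) (Q l) = of_bool (k = l)"
proof (cases "k \<le> l")
  case True
  then show ?thesis
    using lead_coeff_B degree_B by (auto simp: pairing_Q intro: coeff_eq_0)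
next
  case False
  then show ?thesis
    by (simp add: Q_eq pairing_sum_right moment_finite_xi B_orthogonal)
qed

text \<open>By biorthogonality the remainder has zero pairing with \<open>Q\<close> at its own
  degree, but this pairing is its leading coefficient.\<close>

lemma B_expansion:
  assumes "degree P \<le> d"
  shows "P = (\<Sum>m\<le>d. Polynomial.smult (pairing P (Q m)) (B m))"
proof (rule ccontr)
  define R where "R = P - (\<Sum>m\<le>d. Polynomial.smult (pairing P (Q m)) (B m))"
  assume "\<not> ?thesis"
  then have "R \<noteq> 0"
    by (simp add: R_def)
  have "degree R \<le> d"
    unfolding R_def using assms
    by (intro degree_diff_le degree_sum_le) (auto simp: degree_B intro: order_trans[OF degree_smult_le])
  then have "pairing R (Q (degree R)) = 0"
    by (simp add: R_def pairing_diff_left moment_finite_Q pairing_sum_left biorthogonal)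
  then show False
    using \<open>R \<noteq> 0\<close> pairing_Q[of R "degree R"] by simp
qed

section \<open>The Jacobi matrix: band structure and action on \<open>B\<close> and
  \<open>Q\<close>\<close>

abbreviation J :: "nat \<Rightarrow> nat \<Rightarrow> real" where
  "J \<equiv> jacobi_matrix s \<mu> p w n"

lemma pairing_x_B_Q_eq_0:
  assumes "Suc l < m"
  shows "pairing ([:0, 1:] * B l) (Q m) = 0"
proof -
  have "degree ([:0, 1:] * B l) < m"
    using assms degree_B[of l] by (simp add: degree_pCons_eq_if)
  then show ?thesis
    by (simp add: pairing_Q coeff_eq_0)
qed

text \<open>Pairing a finite expansion with \<open>Q k\<close> isolates its \<open>k\<close>-th
  coordinate, which gives uniqueness; \<open>B_expansion\<close> gives existence.\<close>

lemma jacobi_matrix_eq: "J l = (\<lambda>m. pairing ([:0, 1:] * B l) (Q m))"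
  unfolding jacobi_matrix_def
proof (rule the_equality)
  let ?c = "\<lambda>m. pairing ([:0, 1:] * B l) (Q m)"
  have sub: "{m. ?c m \<noteq> 0} \<subseteq> {..Suc l}"
    using pairing_x_B_Q_eq_0 by (auto simp: not_less[symmetric])
  have "degree ([:0, 1:] * B l) \<le> Suc l"
    using degree_B[of l] by (simp add: degree_pCons_eq_if)
  then have "[:0, 1:] * B l = (\<Sum>m\<le>Suc l. Polynomial.smult (?c m) (B m))"
    by (rule B_expansion)
  also have "\<dots> = (\<Sum>m | ?c m \<noteq> 0. Polynomial.smult (?c m) (B m))"
    using sub by (intro sum.mono_neutral_right) auto
  finally show "finite {m. ?c m \<noteq> 0} \<and>
      [:0, 1:] * B l = (\<Sum>m | ?c m \<noteq> 0. Polynomial.smult (?c m) (B m))"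
    using sub finite_subset by blast
next
  fix c assume c: "finite {m. c m \<noteq> 0} \<and>
      [:0, 1:] * B l = (\<Sum>m | c m \<noteq> 0. Polynomial.smult (c m) (B m))"
  show "c = (\<lambda>m. pairing ([:0, 1:] * B l) (Q m))"
  proof
    fix k
    have "pairing ([:0, 1:] * B l) (Q k) = (\<Sum>m | c m \<noteq> 0. c m * of_bool (m = k))"
      unfolding conjunct2[OF c] by (simp only: pairing_sum_left[OF moment_finite_Q] biorthogonal)
    also have "\<dots> = c k"
      using c by (cases "c k = 0") (auto simp: sum_mult_indicator intro!: sum.neutral)
    finally show "c k = pairing ([:0, 1:] * B l) (Q k)"
      by simp
  qed
qed

lemma J_upper: "Suc l < m \<Longrightarrow> J l m = 0"
  using pairing_x_B_Q_eq_0 by (simp add: jacobi_matrix_eq)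

lemma J_superdiagonal: "J l (Suc l) = 1"
proof -
  have "degree ([:0, 1:] * B l) \<le> Suc l"
    using degree_B[of l] by (simp add: degree_pCons_eq_if)
  then show ?thesis
    using lead_coeff_B[of l] by (simp add: jacobi_matrix_eq pairing_Q)
qed

lemma jacobi_B: "x * poly (B l) x = (\<Sum>m\<le>Suc l. J l m * poly (B m) x)"
proof -
  have "degree ([:0, 1:] * B l) \<le> Suc l"
    using degree_B[of l] by (simp add: degree_pCons_eq_if)
  from arg_cong[OF B_expansion[OF this], of "\<lambda>P. poly P x"] show ?thesis
    by (simp add: poly_sum jacobi_matrix_eq del: sum.atMost_Suc)
qed

lemma mult_Q_in_span:
  obtains c where "\<And>x. x * Q m x = (\<Sum>j\<le>m + band_width p n. c j * xi p w n j x)"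
proof -
  have "\<forall>i. \<exists>j. j \<le> i + band_width p n \<and> (\<forall>x. x * xi p w n i x = xi p w n j x)"
    using mult_xi by blast
  from choice[OF this]
  obtain f where f: "\<And>i. f i \<le> i + band_width p n" "\<And>i x. x * xi p w n i x = xi p w n (f i) x"
    by blast
  have f_le: "f j \<le> m + band_width p n" if "j \<le> m" for j
    using f(1)[of j] that by linarith
  \<comment> \<open>\<open>f\<close> comes from a choice, so the coefficient at \<open>k\<close>
    collects all \<open>j\<close> that \<open>f\<close> sends to \<open>k\<close>.\<close>
  define c where "c k = (\<Sum>j\<in>{j\<in>{..m}. f j = k}. typeI_coeff s \<mu> p w n m j)" for k
  have "x * Q m x = (\<Sum>k\<le>m + band_width p n. c k * xi p w n k x)" for x
  proof -
    have "x * Q m x = (\<Sum>j\<le>m. typeI_coeff s \<mu> p w n m j * xi p w n (f j) x)"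
      by (simp add: Q_eq sum_distrib_left f(2)[symmetric] mult.left_commute)
    also have "\<dots> = (\<Sum>k\<le>m + band_width p n. \<Sum>j\<in>{j\<in>{..m}. f j = k}.
        typeI_coeff s \<mu> p w n m j * xi p w n (f j) x)"
      using f_le by (intro sum.group[symmetric]) auto
    also have "\<dots> = (\<Sum>k\<le>m + band_width p n. c k * xi p w n k x)"
      by (simp add: c_def sum_distrib_right)
    finally show ?thesis .
  qed
  then show thesis
    by (rule that)
qed

text \<open>The entry is the pairing of \<open>B k\<close> with \<open>x * Q m x\<close>, which is a
  combination of functions \<open>xi\<close> of index below \<open>k\<close>.\<close>

lemma J_lower:
  assumes "m + band_width p n < k"
  shows "J k m = 0"
proof -
  obtain c where c: "\<And>x. x * Q m x = (\<Sum>j\<le>m + band_width p n. c j * xi p w n j x)"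
    using mult_Q_in_span by blast
  show ?thesis
    using assms unfolding jacobi_matrix_eq pairing_mult_x c
    by (subst pairing_sum_right) (auto simp: moment_finite_xi B_orthogonal)
qed

text \<open>
  The identity is one between coefficients with respect to \<open>\<xi>\<close>, hence it also holds at points
  outside the interval, where the weights are arbitrary.
\<close>
lemma jacobi_Q: "x * Q m x = (\<Sum>k\<le>m + band_width p n. J k m * Q k x)"
proof -
  let ?K = "m + band_width p n"
  let ?t = "typeI_coeff s \<mu> p w n"
  obtain c where c: "\<And>x. x * Q m x = (\<Sum>j\<le>?K. c j * xi p w n j x)"
    using mult_Q_in_span by blast
  \<comment> \<open>The coefficients in the functions \<open>xi\<close> of the difference of the two
    sides; \<open>Q k\<close> contributes at \<open>j\<close> only if \<open>j <= k\<close>.\<close>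
  define d where "d j = c j - (\<Sum>k\<in>{k\<in>{..?K}. j \<le> k}. J k m * ?t k j)" for j
  have Q_ext: "Q k x = (\<Sum>j\<le>?K. of_bool (j \<le> k) * ?t k j * xi p w n j x)" if "k \<le> ?K" for k x
  proof -
    have "(\<Sum>j\<le>k. ?t k j * xi p w n j x) = (\<Sum>j\<le>k. of_bool (j \<le> k) * ?t k j * xi p w n j x)"
      by (rule sum.cong) auto
    also have "\<dots> = (\<Sum>j\<le>?K. of_bool (j \<le> k) * ?t k j * xi p w n j x)"
      using that by (intro sum.mono_neutral_left) auto
    finally show ?thesis
      by (simp add: Q_eq)
  qed
  have diff: "x * Q m x - (\<Sum>k\<le>?K. J k m * Q k x) = (\<Sum>j<Suc ?K. d j * xi p w n j x)" for x
  proof -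
    have "(\<Sum>k\<le>?K. J k m * Q k x)
        = (\<Sum>k\<le>?K. \<Sum>j\<le>?K. J k m * (of_bool (j \<le> k) * ?t k j * xi p w n j x))"
      by (simp add: Q_ext sum_distrib_left)
    also have "\<dots> = (\<Sum>j\<le>?K. \<Sum>k\<le>?K. J k m * (of_bool (j \<le> k) * ?t k j * xi p w n j x))"
      by (rule sum.swap)
    also have "\<dots> = (\<Sum>j\<le>?K. (\<Sum>k\<in>{k\<in>{..?K}. j \<le> k}. J k m * ?t k j) * xi p w n j x)"
      unfolding sum_distrib_right
      by (intro sum.cong refl sum.mono_neutral_cong_right) auto
    finally show ?thesis
      unfolding c d_def left_diff_distrib sum_subtractf lessThan_Suc_atMost by simp
  qed
  \<comment> \<open>Pairing with \<open>B i\<close> turns either side into \<open>J i m\<close>: the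
    left by the formula for \<open>J\<close>, the right by biorthogonality.\<close>
  have zero: "pairing (B i) (\<lambda>x. \<Sum>j<Suc ?K. d j * xi p w n j x) = 0" if "i \<le> ?K" for i
  proof -
    have "moment_finite (\<lambda>x. x * Q m x)"
      unfolding c by (intro moment_finite_sum moment_finite_xi)
    moreover have "moment_finite (\<lambda>x. \<Sum>k\<le>?K. J k m * Q k x)"
      by (intro moment_finite_sum moment_finite_Q)
    ultimately have "pairing (B i) (\<lambda>x. x * Q m x - (\<Sum>k\<le>?K. J k m * Q k x))
        = pairing (B i) (\<lambda>x. x * Q m x) - pairing (B i) (\<lambda>x. \<Sum>k\<le>?K. J k m * Q k x)"
      by (simp add: pairing_def signed_integral_def moment_finite_def right_diff_distrib)
    also have "pairing (B i) (\<lambda>x. \<Sum>k\<le>?K. J k m * Q k x) = (\<Sum>k\<le>?K. J k m * of_bool (k = i))"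
      by (subst pairing_sum_right) (auto simp: moment_finite_Q biorthogonal intro!: sum.cong)
    also have "\<dots> = J i m"
      using that by (simp add: sum_mult_indicator)
    also have "J i m = pairing (B i) (\<lambda>x. x * Q m x)"
      by (simp only: jacobi_matrix_eq pairing_mult_x)
    finally show ?thesis
      by (simp only: diff diff_self)
  qed
  \<comment> \<open>Expanding monomials in the \<open>B k\<close> transfers \<open>zero\<close> to
    moments, which determine the coefficients.\<close>
  have "d j = 0" if "j < Suc ?K" for j
  proof (rule xi_sum_trivial[OF _ that])
    fix i assume i: "i < Suc ?K"
    have f: "moment_finite (\<lambda>x. \<Sum>j<Suc ?K. d j * xi p w n j x)"
      by (intro moment_finite_sum moment_finite_xi)
    have "pairing (Polynomial.monom 1 i) (\<lambda>x. \<Sum>j<Suc ?K. d j * xi p w n j x)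
        = pairing (\<Sum>k\<le>i. Polynomial.smult (pairing (Polynomial.monom 1 i) (Q k)) (B k))
            (\<lambda>x. \<Sum>j<Suc ?K. d j * xi p w n j x)"
      by (intro arg_cong2[of _ _ _ _ pairing] B_expansion degree_monom_le refl)
    also have "\<dots> = (\<Sum>k\<le>i. pairing (Polynomial.monom 1 i) (Q k)
        * pairing (B k) (\<lambda>x. \<Sum>j<Suc ?K. d j * xi p w n j x))"
      by (rule pairing_sum_left[OF f])
    also have "\<dots> = 0"
      using zero i by (intro sum.neutral) (auto simp del: sum.lessThan_Suc)
    finally show "pairing (Polynomial.monom 1 i) (\<lambda>x. \<Sum>j<Suc ?K. d j * xi p w n j x) = 0" .
  qed
  then have "(\<Sum>j<Suc ?K. d j * xi p w n j x) = 0"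
    by (intro sum.neutral) auto
  then have "x * Q m x - (\<Sum>k\<le>?K. J k m * Q k x) = 0"
    by (simp only: diff)
  then show ?thesis
    by simp
qed

section \<open>The recurrence at a fixed point\<close>

lemma band_width_pos: "band_width p n > 0"
proof -
  have "1 \<in> {1..p}"
    using p_pos by simp
  from weight_index_Suc[OF this, of 0] show ?thesis
    by linarith
qed

text \<open>The recurrence before division by \<open>Q (l - 1) x\<close>, obtained from the double
  sum over \<open>k < l\<close>.\<close>

lemma typeII_step:
  fixes x :: real
  defines "N \<equiv> band_width p n"
  assumes l: "N \<le> l"
  shows "Q (l - 1) x * poly (B l) x
    = (\<Sum>i<N. \<Sum>j<N. Q (l + i) x * (J (l + i) (l - N + j) * poly (B (l - N + j)) x))"
proof -
  let ?b = "\<lambda>m. poly (B m) x" and ?q = "\<lambda>m. Q m x"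
  have l0: "l > 0"
    using l band_width_pos unfolding N_def by simp
  have split: "(\<Sum>i<a + b. f i) = (\<Sum>i<a. f i) + (\<Sum>j<b. f (a + j))"
    for f :: "nat \<Rightarrow> real" and a b
    by (induction b) auto
  have "(\<Sum>k<l. ?q k * (x * ?b k)) = (\<Sum>k<l. \<Sum>m\<le>Suc k. ?q k * J k m * ?b m)"
    by (simp only: jacobi_B sum_distrib_left mult.assoc)
  also have "\<dots> = (\<Sum>k<l. \<Sum>m<Suc l. ?q k * J k m * ?b m)"
    by (intro sum.cong refl sum.mono_neutral_left) (auto simp: J_upper)
  also have "\<dots> = (\<Sum>k<l. \<Sum>m<l. ?q k * J k m * ?b m) + (\<Sum>k<l. ?q k * J k l * ?b l)"
    by (simp add: sum.distrib)
  \<comment> \<open>In column \<open>l\<close> the upper band leaves only row \<open>l - 1\<close>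
    among the rows \<open>k < l\<close>, and its entry is the superdiagonal 1.\<close>
  also have "(\<Sum>k<l. ?q k * J k l * ?b l) = (\<Sum>k\<in>{l - 1}. ?q k * J k l * ?b l)"
    using l0 by (intro sum.mono_neutral_right) (auto simp: J_upper)
  also have "\<dots> = ?q (l - 1) * ?b l"
    using J_superdiagonal[of "l - 1"] l0 by simp
  finally have left: "(\<Sum>k<l. ?q k * (x * ?b k))
      = (\<Sum>k<l. \<Sum>m<l. ?q k * J k m * ?b m) + ?q (l - 1) * ?b l" .
  have "(\<Sum>m<l. x * ?q m * ?b m) = (\<Sum>m<l. \<Sum>k\<le>m + N. ?q k * J k m * ?b m)"
    unfolding jacobi_Q N_def sum_distrib_right by (simp only: mult.commute)
  \<comment> \<open>The lower band allows one common range for \<open>k\<close>, which then splits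
    at \<open>l\<close>.\<close>
  also have "\<dots> = (\<Sum>m<l. \<Sum>k<l + N. ?q k * J k m * ?b m)"
    by (intro sum.cong refl sum.mono_neutral_left) (auto simp: J_lower N_def)
  also have "\<dots> = (\<Sum>m<l. \<Sum>k<l. ?q k * J k m * ?b m) + (\<Sum>m<l. \<Sum>i<N. ?q (l + i) * J (l + i) m * ?b m)"
    by (simp only: split sum.distrib)
  also have "(\<Sum>m<l. \<Sum>k<l. ?q k * J k m * ?b m) = (\<Sum>k<l. \<Sum>m<l. ?q k * J k m * ?b m)"
    by (rule sum.swap)
  also have "(\<Sum>m<l. \<Sum>i<N. ?q (l + i) * J (l + i) m * ?b m)
      = (\<Sum>i<N. \<Sum>m<l. ?q (l + i) * J (l + i) m * ?b m)"
    by (rule sum.swap)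
  also have "\<dots> = (\<Sum>i<N. \<Sum>j<N. ?q (l + i) * (J (l + i) (l - N + j) * ?b (l - N + j)))"
  proof (rule sum.cong[OF refl])
    fix i
    have "(\<Sum>m<l. ?q (l + i) * J (l + i) m * ?b m) = (\<Sum>m<l - N + N. ?q (l + i) * J (l + i) m * ?b m)"
      using l by simp
    also have "\<dots> = (\<Sum>m<l - N. ?q (l + i) * J (l + i) m * ?b m)
        + (\<Sum>j<N. ?q (l + i) * J (l + i) (l - N + j) * ?b (l - N + j))"
      by (rule split)
    \<comment> \<open>Here \<open>m + N < l <= l + i\<close>, which is below the band.\<close>
    also have "(\<Sum>m<l - N. ?q (l + i) * J (l + i) m * ?b m) = 0"
      by (intro sum.neutral) (auto simp: J_lower N_def)
    finally show "(\<Sum>m<l. ?q (l + i) * J (l + i) m * ?b m)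
        = (\<Sum>j<N. ?q (l + i) * (J (l + i) (l - N + j) * ?b (l - N + j)))"
      by (simp add: mult.assoc)
  qed
  finally have right: "(\<Sum>m<l. x * ?q m * ?b m) = (\<Sum>k<l. \<Sum>m<l. ?q k * J k m * ?b m)
      + (\<Sum>i<N. \<Sum>j<N. ?q (l + i) * (J (l + i) (l - N + j) * ?b (l - N + j)))" .
  have "(\<Sum>k<l. ?q k * (x * ?b k)) = (\<Sum>m<l. x * ?q m * ?b m)"
    by (simp add: mult.left_commute mult.assoc)
  with left right show ?thesis
    by simp
qed

lemma typeII_recurrence:
  assumes l: "band_width p n \<le> l" and nonzero: "Q (l - 1) x \<noteq> 0"
  shows "scalar_prod (ratio_vec (band_width p n) (\<lambda>k. Q k x) l)
      (corner_matrix (band_width p n) J l *\<^sub>v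
        Matrix.vec (band_width p n) (\<lambda>j. poly (B (l - band_width p n + j)) x))
    = poly (B l) x"
proof -
  let ?N = "band_width p n"
  \<comment> \<open>For \<open>i > j\<close> the entry of \<open>J\<close> is below the band, so the
    zeros put into the triangular matrix agree with \<open>J\<close>.\<close>
  have corner: "corner_matrix ?N J l $$ (i, j) = J (l + i) (l - ?N + j)" if "i < ?N" "j < ?N" for i j
    using that l by (simp add: corner_matrix_def J_lower)
  have "scalar_prod (ratio_vec ?N (\<lambda>k. Q k x) l)
      (corner_matrix ?N J l *\<^sub>v Matrix.vec ?N (\<lambda>j. poly (B (l - ?N + j)) x))
    = (\<Sum>i<?N. \<Sum>j<?N. Q (l + i) x * (J (l + i) (l - ?N + j) * poly (B (l - ?N + j)) x)) / Q (l - 1) x"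
    by (simp add: scalar_prod_ratio_vec corner_matrix_carrier corner sum_divide_distrib)
  also have "\<dots> = poly (B l) x"
    using nonzero by (simp add: typeII_step[OF l, symmetric])
  finally show ?thesis .
qed

end

section \<open>The recurrence for the type II polynomials\<close>

theorem corollary1:
  fixes \<Delta> :: "real set" and s :: real and \<mu> :: "real measure"
    and p :: nat and w :: "nat \<Rightarrow> real \<Rightarrow> real" and nv :: "nat \<Rightarrow> nat"
    and B :: "nat \<Rightarrow> real poly" and Q :: "nat \<Rightarrow> real \<Rightarrow> real" and J :: "nat \<Rightarrow> nat \<Rightarrow> real"
    and N :: nat and lam rI :: real and c :: "nat \<Rightarrow> real" and r :: "nat \<Rightarrow> complex"
    and \<phi> \<Phi> :: "real poly" and \<alpha> :: "nat \<Rightarrow> nat \<Rightarrow> real"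
  assumes "mop_system \<Delta> s \<mu> p w nv"
    and "B = typeII_poly s \<mu> p w nv"
    and "Q = typeI_form s \<mu> p w nv"
    and "J = jacobi_matrix s \<mu> p w nv"
    and "N = band_width p nv"
    and "\<And>j. j \<le> N \<Longrightarrow> (\<lambda>n. J (n + j) n) \<longlonglongrightarrow> c j"
    and "c N \<noteq> 0"
    and "\<phi> = phi_poly N c lam"
    and "poly \<phi> rI = 0"
    and "(\<lambda>n. Q (n + 1) lam / Q n lam) \<longlonglongrightarrow> 1 / rI"
    and "proots (map_poly complex_of_real \<phi>)
           = add_mset (complex_of_real rI) (image_mset r (mset_set {1..N}))"
    and "\<alpha> = typeII_rec_coeff N J (\<lambda>n. Q n lam)"
    and "\<Phi> = rec_char_poly N \<alpha>"
  shows "(\<forall>n\<ge>N. Q (n - 1) lam \<noteq> 0 \<longrightarrow>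
            scalar_prod (ratio_vec N (\<lambda>n. Q n lam) n)
              (corner_matrix N J n *\<^sub>v Matrix.vec N (\<lambda>j. poly (B (n - N + j)) lam))
            = poly (B n) lam)
       \<and> (\<forall>n. Q (n + N - 1) lam \<noteq> 0 \<longrightarrow> (\<Sum>i\<le>N. \<alpha> i n * poly (B (n + i)) lam) = 0)
       \<and> (\<forall>i\<le>N. convergent (\<lambda>n. \<alpha> i n))
       \<and> [:- rI, 1:] dvd \<phi>
       \<and> \<Phi> = - (\<phi> div [:- rI, 1:])
       \<and> map_poly complex_of_real \<Phi> = - (\<Prod>i=1..N. [:- r i, 1:])
       \<and> (Polynomial.order rI \<phi> = 1 \<longrightarrow> poly \<Phi> rI \<noteq> 0)
       \<and> (\<forall>m>1. Polynomial.order rI \<phi> = m \<longrightarrow> poly \<Phi> rI = 0 \<and> Polynomial.order rI \<Phi> = m - 1)"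
proof -
  interpret mop_system \<Delta> s \<mu> p w nv
    by fact
  let ?y = "\<lambda>n. Q n lam"
  \<comment> \<open>That the constant term is \<open>c N\<close> relies on
    \<open>N > 0\<close>.\<close>
  have "c N = poly \<phi> 0"
    using assms(8) by (simp add: poly_0_coeff_0 coeff_phi_poly) (use band_width_pos assms(5) in auto)
  then have "rI \<noteq> 0"
    using assms(7,9) by auto
  have rec: "scalar_prod (ratio_vec N ?y n)
      (corner_matrix N J n *\<^sub>v Matrix.vec N (\<lambda>j. poly (B (n - N + j)) lam)) = poly (B n) lam"
    if "n \<ge> N" "Q (n - 1) lam \<noteq> 0" for n
    using typeII_recurrence[of n lam] that assms(2-5) by simp
  \<comment> \<open>The matrix form at \<open>n + N\<close>, so that the lowest index
    \<open>n + N - N\<close> is \<open>n\<close>.\<close>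
  have rec': "(\<Sum>i\<le>N. \<alpha> i n * poly (B (n + i)) lam) = 0" if "Q (n + N - 1) lam \<noteq> 0" for n
    using rec[of "n + N"] that typeII_rec_coeff_sum[of N J ?y n "\<lambda>m. poly (B m) lam"]
    by (simp add: assms(12))
  have lims: "\<alpha> i \<longlonglongrightarrow> (\<Sum>k\<le>i. (1 / rI) ^ Suc k * c (N + k - i))" if "i < N" for i
    unfolding assms(12) using \<open>rI \<noteq> 0\<close> that
    by (intro typeII_rec_coeff_tendsto assms(6,10)) auto
  have "\<alpha> N = (\<lambda>n. - 1)"
    by (rule ext) (simp add: assms(12) typeII_rec_coeff_def)
  then have limN: "\<alpha> N \<longlonglongrightarrow> - 1"
    by simp
  have conv: "convergent (\<alpha> i)" if "i \<le> N" for i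
    using convergentI[OF lims[of i]] convergentI[OF limN] that by (cases "i = N") auto
  have coeff: "coeff \<Phi> i = (if i \<le> N then lim (\<alpha> i) else 0)" for i
    by (simp add: assms(13) rec_char_poly_def coeff_sum)
  have factor: "\<phi> = [:- rI, 1:] * - \<Phi>"
    unfolding assms(8) using assms(8,9) \<open>rI \<noteq> 0\<close>
    by (intro phi_poly_factor) (simp_all add: coeff limI[OF lims] limI[OF limN])
  have "lead_coeff \<phi> = 1"
    by (simp add: assms(8) degree_phi_poly coeff_phi_poly)
  note complex = complex_factorization_of_linear_factor[OF factor this assms(11)]
  have "\<phi> \<noteq> 0"
    using \<open>lead_coeff \<phi> = 1\<close> by auto
  then have "\<Phi> \<noteq> 0"
    using factor by auto
  \<comment> \<open>Orders add over products, and the linear factor contributes exactly 1.\<close>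
  have order: "Polynomial.order rI \<phi> = Suc (Polynomial.order rI \<Phi>)"
  proof -
    have "Polynomial.order rI \<phi> = Polynomial.order rI [:- rI, 1:] + Polynomial.order rI (- \<Phi>)"
      using \<open>\<phi> \<noteq> 0\<close> unfolding factor by (rule order_mult)
    then show ?thesis
      using order_power_n_n[of rI 1] by simp
  qed
  have "\<phi> div [:- rI, 1:] = - \<Phi>"
    unfolding factor by (rule nonzero_mult_div_cancel_left) simp
  then have quotient: "\<Phi> = - (\<phi> div [:- rI, 1:])"
    by simp
  have dvd: "[:- rI, 1:] dvd \<phi>"
    unfolding factor by (rule dvd_triv_left)
  show ?thesis
  proof (intro conjI allI impI)
    show "poly \<Phi> rI \<noteq> 0" if "Polynomial.order rI \<phi> = 1"
      using order that \<open>\<Phi> \<noteq> 0\<close> by (simp add: order_root)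
    show "poly \<Phi> rI = 0" "Polynomial.order rI \<Phi> = m - 1"
      if "1 < m" "Polynomial.order rI \<phi> = m" for m
      using order that by (simp_all add: order_root)
  qed (rule rec rec' conv complex dvd quotient; assumption)+
qed

end
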